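(* Let $\Omega\subseteq\mathbb{R}^d$ be a Borel set, let $\eta,\nu\in\mathbb{P}(\Omega)$, let $\mathcal{T}$ be a class of functions in a Banach space of mappings from $\Omega$ to itself, let $\widehat{\mathcal{T}}\subseteq\mathcal{T}$ be a closed subset, and let $D$ be a divergence on $\mathbb{P}(\Omega)$. Assume: (i) (Stability) there exist a constant $C>0$ and a norm $\|\cdot\|$ of an ambient space containing $\mathcal{T}$ such that $D(F_\sharp\eta,G_\sharp\eta)\le C\|F-G\|$ for all $F,G\in\mathcal{T}$ (with $C$ independent of $F,G$); (ii) (Feasibility) there exists a map $T^\dagger\in\mathcal{T}$ satisfying $T^\dagger_\sharp\eta=\nu$. Let $\widehat{T}\in\operatorname{arg\,min}_{S\in\widehat{\mathcal{T}}}D(S_\sharp\eta,\nu)$ be an arbitrary choice of global minimizer and let $\widehat{\nu}=\widehat{T}_\sharp\eta$. Then $$D(\widehat{\nu},\nu)\le C\,\operatorname{dist}_{\|\cdot\|}(\widehat{\mathcal{T}},T^\dagger),$$ where $C$ is the same constant as in (i).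
   Context: $\mathbb{P}(\Omega)$ is the set of Borel probability measures on $\Omega$. For a measurable map $T$, $T_\sharp\eta(A)=\eta(T^{-1}(A))$ is the pushforward. A divergence is a function $D:\mathbb{P}(\Omega)\times\mathbb{P}(\Omega)\to[0,+\infty]$ with $D(\mu,\mu')=0$ if and only if $\mu=\mu'$ (it may also be defined only on some subset of $\mathbb{P}(\Omega)$ containing $\nu$ and $\eta$). $\operatorname{dist}_{\|\cdot\|}(\widehat{\mathcal{T}},T^\dagger)=\inf_{T\in\widehat{\mathcal{T}}}\|T-T^\dagger\|$. *)

theory Defs
  imports "HOL-Probability.Probability"
begin

definition borel_prob_measures :: "'a::topological_space set \<Rightarrow> 'a measure set" where
  "borel_prob_measures \<Omega> = space (prob_algebra (restrict_space borel \<Omega>))"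

definition pushforward ::
    "'a::topological_space set \<Rightarrow> 'a measure \<Rightarrow> ('a \<Rightarrow> 'a) \<Rightarrow> 'a measure" where
  "pushforward \<Omega> \<eta> F = distr \<eta> (restrict_space borel \<Omega>) F"

text \<open>
  A divergence may be defined only on a subset \<open>P\<close> of the probability measures.
  Nonnegativity is built into the codomain \<open>ennreal\<close>.
\<close>

definition divergence_on ::
    "'a measure set \<Rightarrow> ('a measure \<Rightarrow> 'a measure \<Rightarrow> ennreal) \<Rightarrow> bool" where
  "divergence_on P D \<longleftrightarrow> (\<forall>\<mu>\<in>P. \<forall>\<mu>'\<in>P. D \<mu> \<mu>' = 0 \<longleftrightarrow> \<mu> = \<mu>')"

text \<open>
  A normed space of functions on \<open>space \<eta>\<close>. Functions are total on the type, but their values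
  outside \<open>space \<eta>\<close> carry no information; hence a function vanishing on \<open>space \<eta>\<close> has
  norm zero. Definiteness is required modulo \<open>\<eta>\<close>-null sets, so that both norms
  that are definite pointwise (such as a supremum norm) and norms on spaces of classes
  (such as the norm of \<open>L\<^sup>p(\<eta>)\<close>, with functions standing for their classes) are covered.
\<close>

definition normed_function_space ::
    "'a measure \<Rightarrow> ('a \<Rightarrow> 'b::real_vector) set \<Rightarrow> (('a \<Rightarrow> 'b) \<Rightarrow> real) \<Rightarrow> bool" where
  "normed_function_space \<eta> V N \<longleftrightarrow>
     (\<lambda>x. 0) \<in> V \<and>
     (\<forall>f\<in>V. \<forall>g\<in>V. (\<lambda>x. f x + g x) \<in> V) \<and>
     (\<forall>c. \<forall>f\<in>V. (\<lambda>x. c *\<^sub>R f x) \<in> V) \<and>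
     (\<forall>f\<in>V. 0 \<le> N f) \<and>
     (\<forall>f\<in>V. \<forall>g\<in>V. N (\<lambda>x. f x + g x) \<le> N f + N g) \<and>
     (\<forall>c. \<forall>f\<in>V. N (\<lambda>x. c *\<^sub>R f x) = \<bar>c\<bar> * N f) \<and>
     (\<forall>f\<in>V. (\<forall>x\<in>space \<eta>. f x = 0) \<longrightarrow> N f = 0) \<and>
     (\<forall>f\<in>V. N f = 0 \<longrightarrow> (AE x in \<eta>. f x = 0))"

definition norm_dist :: "(('a \<Rightarrow> 'b::real_vector) \<Rightarrow> real) \<Rightarrow> ('a \<Rightarrow> 'b) \<Rightarrow> ('a \<Rightarrow> 'b) \<Rightarrow> real" where
  "norm_dist N f g = N (\<lambda>x. f x - g x)"

definition banach_function_space ::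
    "'a measure \<Rightarrow> ('a \<Rightarrow> 'b::real_vector) set \<Rightarrow> (('a \<Rightarrow> 'b) \<Rightarrow> real) \<Rightarrow> bool" where
  "banach_function_space \<eta> V N \<longleftrightarrow>
     normed_function_space \<eta> V N \<and>
     (\<forall>u. (\<forall>n. u n \<in> V) \<and>
          (\<forall>e>0. \<exists>M. \<forall>m\<ge>M. \<forall>n\<ge>M. norm_dist N (u m) (u n) < e) \<longrightarrow>
          (\<exists>f\<in>V. (\<lambda>n. norm_dist N (u n) f) \<longlonglongrightarrow> 0))"

text \<open>
  \<open>S\<close> is a closed subset of \<open>T\<close> in the topology of the norm \<open>N\<close>. As functions at distance zero
  are identified, a limit need only agree with a member of \<open>S\<close> up to this identification.
\<close>

definition closed_subset_in_norm ::
    "(('a \<Rightarrow> 'b::real_vector) \<Rightarrow> real) \<Rightarrow> ('a \<Rightarrow> 'b) set \<Rightarrow> ('a \<Rightarrow> 'b) set \<Rightarrow> bool" where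
  "closed_subset_in_norm N T S \<longleftrightarrow>
     S \<subseteq> T \<and>
     (\<forall>u. \<forall>f\<in>T. (\<forall>n. u n \<in> S) \<and> (\<lambda>n. norm_dist N (u n) f) \<longlonglongrightarrow> 0 \<longrightarrow>
          (\<exists>g\<in>S. norm_dist N g f = 0))"

definition set_dist_norm ::
    "(('a \<Rightarrow> 'b::real_vector) \<Rightarrow> real) \<Rightarrow> ('a \<Rightarrow> 'b) set \<Rightarrow> ('a \<Rightarrow> 'b) \<Rightarrow> real" where
  "set_dist_norm N S f = (INF g\<in>S. norm_dist N g f)"

end

theory Submission
  imports Defs
begin

text \<open>
  The target \<open>\<nu>\<close> is itself the pushforward of \<open>\<eta>\<close> under \<open>T_dagger\<close>, so stability turns the distance in
  the norm from any competitor \<open>S\<close> to \<open>T_dagger\<close> into a bound on the divergence from the pushforward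
  under \<open>S\<close> to \<open>\<nu>\<close>. A minimizer does at least as well as every competitor, so the bound for each
  \<open>S\<close> is also a bound for the minimizer, and taking the infimum over \<open>S\<close> gives the claim.

  The one point that calls for care is the infimum. It is taken in the reals, where it is meaningful
  only over a nonempty set and a family bounded below, while the divergence takes values in \<open>[0, \<infinity>]\<close>.
  The minimizer shows that the set is nonempty, the norm is nonnegative
  (\<open>norm_dist_nonneg\<close>), and the passage between the two codomains is \<open>le_ennreal_mult_INF\<close>.
\<close>

lemma norm_dist_nonneg:
  assumes V: "normed_function_space \<eta> V N" and f: "f \<in> V" and g: "g \<in> V"
  shows "0 \<le> norm_dist N f g"
proof -
  have add: "\<And>u v. u \<in> V \<Longrightarrow> v \<in> V \<Longrightarrow> (\<lambda>x. u x + v x) \<in> V"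
    and scale: "\<And>c u. u \<in> V \<Longrightarrow> (\<lambda>x. c *\<^sub>R u x) \<in> V"
    and pos: "\<And>u. u \<in> V \<Longrightarrow> 0 \<le> N u"
    using V unfolding normed_function_space_def by simp_all
  have "(\<lambda>x. f x - g x) \<in> V"
    using add[OF f scale[OF g, of "-1"]] by simp
  then show ?thesis
    unfolding norm_dist_def by (rule pos)
qed

text \<open>
  A single bound already makes \<open>a\<close> finite, hence a nonnegative real. After division by \<open>c\<close> it is
  an ordinary lower bound of the family, so it lies below the real infimum.
\<close>

lemma le_ennreal_mult_INF:
  fixes a :: ennreal and c :: real
  assumes ne: "A \<noteq> {}" and c: "0 < c"
    and nonneg: "\<And>x. x \<in> A \<Longrightarrow> 0 \<le> f x"
    and bound: "\<And>x. x \<in> A \<Longrightarrow> a \<le> ennreal (c * f x)"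
  shows "a \<le> ennreal (c * (INF x\<in>A. f x))"
proof -
  obtain x where "x \<in> A" using ne by blast
  then have "a < top"
    using bound le_less_trans[OF _ ennreal_less_top] by blast
  then obtain r where a: "a = ennreal r"
    by (cases a) auto
  have "r / c \<le> f x" if "x \<in> A" for x
    using bound[OF that] nonneg[OF that] c
    by (simp add: a ennreal_le_iff pos_divide_le_eq mult.commute)
  then have "r / c \<le> (INF x\<in>A. f x)"
    using ne by (intro cINF_greatest)
  then have "r \<le> c * (INF x\<in>A. f x)"
    using c by (simp add: pos_divide_le_eq mult.commute)
  then show ?thesis
    unfolding a by (rule ennreal_leI)
qed

theorem theorem2p2:
  fixes \<Omega> :: "(real ^ 'd) set"
    and \<eta> \<nu> :: "(real ^ 'd) measure"
    and B V :: "(real ^ 'd \<Rightarrow> real ^ 'd) set"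
    and N\<^sub>B N :: "(real ^ 'd \<Rightarrow> real ^ 'd) \<Rightarrow> real"
    and \<T> \<T>\<^sub>h :: "(real ^ 'd \<Rightarrow> real ^ 'd) set"
    and P :: "(real ^ 'd) measure set"
    and D :: "(real ^ 'd) measure \<Rightarrow> (real ^ 'd) measure \<Rightarrow> ennreal"
    and C :: real
    and T_dagger T\<^sub>h :: "real ^ 'd \<Rightarrow> real ^ 'd"
    and \<nu>\<^sub>h :: "(real ^ 'd) measure"
  assumes "\<Omega> \<in> sets borel"
    and "\<eta> \<in> borel_prob_measures \<Omega>"
    and "\<nu> \<in> borel_prob_measures \<Omega>"
    and banach: "banach_function_space \<eta> B N\<^sub>B"
    and "\<T> \<subseteq> B"
    and maps: "\<T> \<subseteq> restrict_space borel \<Omega> \<rightarrow>\<^sub>M restrict_space borel \<Omega>"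
    and closed: "closed_subset_in_norm N\<^sub>B \<T> \<T>\<^sub>h"
    and "P \<subseteq> borel_prob_measures \<Omega>"
    and "\<eta> \<in> P"
    and "\<nu> \<in> P"
    and "\<And>F. F \<in> \<T> \<Longrightarrow> pushforward \<Omega> \<eta> F \<in> P"
    and divergence: "divergence_on P D"
    and ambient: "normed_function_space \<eta> V N" "\<T> \<subseteq> V"
    and stability: "C > 0"
      "\<And>F G. F \<in> \<T> \<Longrightarrow> G \<in> \<T> \<Longrightarrow>
         D (pushforward \<Omega> \<eta> F) (pushforward \<Omega> \<eta> G) \<le> ennreal (C * norm_dist N F G)"
    and feasibility: "T_dagger \<in> \<T>" "pushforward \<Omega> \<eta> T_dagger = \<nu>"
    and minimizer: "is_arg_min (\<lambda>S. D (pushforward \<Omega> \<eta> S) \<nu>) (\<lambda>S. S \<in> \<T>\<^sub>h) T\<^sub>h"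
    and "\<nu>\<^sub>h = pushforward \<Omega> \<eta> T\<^sub>h"
  shows "D \<nu>\<^sub>h \<nu> \<le> ennreal (C * set_dist_norm N \<T>\<^sub>h T_dagger)"
proof -
  have sub: "\<T>\<^sub>h \<subseteq> \<T>"
    using closed by (simp add: closed_subset_in_norm_def)
  have Th: "T\<^sub>h \<in> \<T>\<^sub>h"
    using minimizer by (simp add: is_arg_min_def)
  have "D \<nu>\<^sub>h \<nu> \<le> ennreal (C * norm_dist N S T_dagger)" if S: "S \<in> \<T>\<^sub>h" for S
  proof -
    have "D \<nu>\<^sub>h \<nu> \<le> D (pushforward \<Omega> \<eta> S) \<nu>"
      using minimizer S \<open>\<nu>\<^sub>h = pushforward \<Omega> \<eta> T\<^sub>h\<close>
      by (simp add: is_arg_min_linorder)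
    also have "\<dots> \<le> ennreal (C * norm_dist N S T_dagger)"
      using stability(2)[of S T_dagger] S sub feasibility by auto
    finally show ?thesis .
  qed
  moreover have "0 \<le> norm_dist N S T_dagger" if "S \<in> \<T>\<^sub>h" for S
    using norm_dist_nonneg[OF ambient(1)] ambient(2) sub feasibility(1) that by blast
  ultimately show ?thesis
    unfolding set_dist_norm_def using Th stability(1) by (intro le_ennreal_mult_INF) auto
qed

end
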